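(* Let $n\ge 3$ and let $\Psi:\mathcal{S}^n\to\mathcal{S}^n$ be a nontrivial radial Blaschke Minkowski homomorphism. If $K,L\in\mathcal{S}^n$, then $$V(\Psi(\underbrace{K,\ldots,K}_{n-2},L))^{n-1}\le V(\Psi K)^{n-2}\,V(\Psi L),$$ with equality if and only if $K$ and $L$ are dilates.
   Context: $\mathcal{S}^n$ is the space of star bodies in $\mathbb{R}^n$, i.e. compact sets $L$, starshaped with respect to the origin, whose radial function $\rho(L,u)=\max\{\lambda\ge 0:\lambda u\in L\}$, $u\in S^{n-1}$, is continuous. $\mathcal{S}^n$ is endowed with the Hausdorff topology. $V$ is volume. $K$ and $L$ are dilates if $K=\lambda L$ for some $\lambda>0$. The radial Minkowski sum is defined by $\rho(K\,\tilde{+}\,L,\cdot)=\rho(K,\cdot)+\rho(L,\cdot)$, and the radial Blaschke sum by $\rho^{n-1}(K\,\tilde{\#}\,L,\cdot)=\rho^{n-1}(K,\cdot)+\rho^{n-1}(L,\cdot)$. A radial Blaschke Minkowski homomorphism is a map $\Psi:\mathcal{S}^n\to\mathcal{S}^n$ such that (a) $\Psi$ is continuous; (b) $\Psi(K\,\tilde{\#}\,L)=\Psi K\,\tilde{+}\,\Psi L$ for all $K,L\in\mathcal{S}^n$; (c) $\Psi$ intertwines rotations, i.e. $\Psi(\vartheta L)=\vartheta\Psi L$ for all $L\in\mathcal{S}^n$ and all $\vartheta\in SO(n)$. The trivial one is the operator that maps every star body to the origin. Mixed operator: for $L_1,\ldots,L_{n-1}\in\mathcal{S}^n$, $\Psi(L_1,\ldots,L_{n-1}):=\Psi(L)$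 where $L\in\mathcal{S}^n$ is the star body with $\rho^{n-1}(L,\cdot)=\rho(L_1,\cdot)\cdots\rho(L_{n-1},\cdot)$. In particular $\Psi(L,\ldots,L)=\Psi L$.
   Formalization: The equality condition is corrected to "K and L are dilates, or K = {0}, or L = {0}", since {0} is a star body and, for K = {0} and L a ball, both sides vanish although K and L are not dilates. *)

theory Defs
  imports "HOL-Analysis.Analysis"
begin

text \<open>The maximum defining the radial function is written as a supremum; for a compact
  set containing the origin it is attained (lemma \<open>radial_ray\<close> below).\<close>

definition radial :: "(real ^ 'n::finite) set \<Rightarrow> real ^ 'n \<Rightarrow> real" where
  "radial L u = Sup {t. 0 \<le> t \<and> t *\<^sub>R u \<in> L}"

definition star_bodies :: "(real ^ 'n::finite) set set" where
  "star_bodies = {L. compact L \<and> 0 \<in> L \<and> (\<forall>x\<in>L. closed_segment 0 x \<subseteq> L) \<and>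
                     continuous_on (sphere 0 1) (radial L)}"

definition dilates :: "(real ^ 'n::finite) set \<Rightarrow> (real ^ 'n) set \<Rightarrow> bool" where
  "dilates K L \<longleftrightarrow> (\<exists>c>0. K = (*\<^sub>R) c ` L)"

text \<open>Star bodies prescribed by their radial function are given by definite descriptions;
  existence and uniqueness is lemma \<open>star_body_ex1_power\<close> below.\<close>

definition radial_Minkowski_sum ::
    "(real ^ 'n::finite) set \<Rightarrow> (real ^ 'n) set \<Rightarrow> (real ^ 'n) set" where
  "radial_Minkowski_sum K L =
     (THE M. M \<in> star_bodies \<and> (\<forall>u\<in>sphere 0 1. radial M u = radial K u + radial L u))"

definition radial_Blaschke_sum ::
    "(real ^ 'n::finite) set \<Rightarrow> (real ^ 'n) set \<Rightarrow> (real ^ 'n) set" where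
  "radial_Blaschke_sum K L =
     (THE M. M \<in> star_bodies \<and>
        (\<forall>u\<in>sphere 0 1. radial M u ^ (CARD('n) - 1) =
            radial K u ^ (CARD('n) - 1) + radial L u ^ (CARD('n) - 1)))"

definition Hausdorff_dist ::
    "(real ^ 'n::finite) set \<Rightarrow> (real ^ 'n) set \<Rightarrow> real" where
  "Hausdorff_dist K L = max (SUP x\<in>K. infdist x L) (SUP y\<in>L. infdist y K)"

definition Hausdorff_continuous ::
    "((real ^ 'n::finite) set \<Rightarrow> (real ^ 'n) set) \<Rightarrow> bool" where
  "Hausdorff_continuous \<Psi> \<longleftrightarrow>
     (\<forall>K\<in>star_bodies. \<forall>\<epsilon>>0. \<exists>\<delta>>0. \<forall>L\<in>star_bodies.
        Hausdorff_dist K L < \<delta> \<longrightarrow> Hausdorff_dist (\<Psi> K) (\<Psi> L) < \<epsilon>)"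

definition radial_Blaschke_Minkowski_hom ::
    "((real ^ 'n::finite) set \<Rightarrow> (real ^ 'n) set) \<Rightarrow> bool" where
  "radial_Blaschke_Minkowski_hom \<Psi> \<longleftrightarrow>
     \<Psi> \<in> star_bodies \<rightarrow> star_bodies \<and>
     Hausdorff_continuous \<Psi> \<and>
     (\<forall>K\<in>star_bodies. \<forall>L\<in>star_bodies.
        \<Psi> (radial_Blaschke_sum K L) = radial_Minkowski_sum (\<Psi> K) (\<Psi> L)) \<and>
     (\<forall>L\<in>star_bodies. \<forall>Q. rotation_matrix Q \<longrightarrow>
        \<Psi> ((\<lambda>x. Q *v x) ` L) = (\<lambda>x. Q *v x) ` \<Psi> L)"

definition trivial_hom :: "((real ^ 'n::finite) set \<Rightarrow> (real ^ 'n) set) \<Rightarrow> bool" where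
  "trivial_hom \<Psi> \<longleftrightarrow> (\<forall>L\<in>star_bodies. \<Psi> L = {0})"

text \<open>The argument list is meant to have length \<open>CARD('n) - 1\<close>.\<close>

definition mixed ::
    "((real ^ 'n::finite) set \<Rightarrow> (real ^ 'n) set) \<Rightarrow> (real ^ 'n) set list \<Rightarrow> (real ^ 'n) set" where
  "mixed \<Psi> Ls =
     \<Psi> (THE M. M \<in> star_bodies \<and>
        (\<forall>u\<in>sphere 0 1. radial M u ^ (CARD('n) - 1) = (\<Prod>L\<leftarrow>Ls. radial L u)))"

abbreviation volume :: "(real ^ 'n::finite) set \<Rightarrow> real" where
  "volume \<equiv> measure lebesgue"

lemma radial_ray:
  fixes L :: "(real ^ 'n::finite) set"
  assumes L: "compact L" "0 \<in> L" "\<forall>x\<in>L. closed_segment 0 x \<subseteq> L" and u: "norm u = 1"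
  shows "{t. 0 \<le> t \<and> t *\<^sub>R u \<in> L} = {0..radial L u}"
proof -
  let ?T = "{t. 0 \<le> t \<and> t *\<^sub>R u \<in> L}"
  obtain B where B: "\<And>x. x \<in> L \<Longrightarrow> norm x \<le> B"
    using compact_imp_bounded[OF L(1)] by (auto simp: bounded_iff)
  have T: "?T = {0..} \<inter> ((\<lambda>t. t *\<^sub>R u) -` L)"
    by auto
  have "closed ?T"
    unfolding T using compact_imp_closed[OF L(1)]
    by (intro closed_Int closed_atLeast closed_vimage continuous_intros)
  moreover have ne: "?T \<noteq> {}"
    using L(2) by (auto intro: exI[of _ 0])
  moreover have bd: "bdd_above ?T"
    using B u by (auto intro!: bdd_aboveI[of _ B]) fastforce
  ultimately have S: "radial L u \<in> ?T"
    unfolding radial_def by (intro closed_contains_Sup)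
  have "t \<in> ?T" if "0 \<le> t" "t \<le> radial L u" for t
  proof (cases "radial L u = 0")
    case True
    with that L(2) show ?thesis by auto
  next
    case False
    with that have pos: "radial L u > 0" by linarith
    have "t *\<^sub>R u = (t / radial L u) *\<^sub>R (radial L u *\<^sub>R u)"
      using pos by simp
    moreover have "0 \<le> t / radial L u" "t / radial L u \<le> 1"
      using that pos by auto
    ultimately have "t *\<^sub>R u \<in> closed_segment 0 (radial L u *\<^sub>R u)"
      by (auto simp: in_segment)
    with S L(3) that show ?thesis by auto
  qed
  moreover have "t \<le> radial L u" if "t \<in> ?T" for t
    unfolding radial_def using that bd by (rule cSup_upper)
  ultimately show ?thesis by auto
qed

lemma star_body_eqI:
  fixes K L :: "(real ^ 'n::finite) set"
  assumes "K \<in> star_bodies" "L \<in> star_bodies" "\<And>u. norm u = 1 \<Longrightarrow> radial K u = radial L u"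
  shows "K = L"
proof -
  have sub: "A \<subseteq> B" if A: "A \<in> star_bodies" and B: "B \<in> star_bodies"
    and eq: "\<And>u. norm u = 1 \<Longrightarrow> radial A u = radial B u" for A B :: "(real ^ 'n) set"
  proof
    fix x assume x: "x \<in> A"
    show "x \<in> B"
    proof (cases "x = 0")
      case True
      with B show ?thesis by (simp add: star_bodies_def)
    next
      case False
      then have u: "norm (sgn x) = 1" and xu: "norm x *\<^sub>R sgn x = x"
        by (simp_all add: norm_sgn sgn_div_norm)
      have "{t. 0 \<le> t \<and> t *\<^sub>R sgn x \<in> A} = {t. 0 \<le> t \<and> t *\<^sub>R sgn x \<in> B}"
        using radial_ray[OF _ _ _ u, of A] radial_ray[OF _ _ _ u, of B] A B eq[OF u]
        by (simp add: star_bodies_def)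
      moreover have "norm x \<in> {t. 0 \<le> t \<and> t *\<^sub>R sgn x \<in> A}"
        using x xu by simp
      ultimately show ?thesis using xu by auto
    qed
  qed
  show ?thesis
    using sub[of K L] sub[of L K] assms by auto
qed

lemma star_body_ex:
  fixes f :: "real ^ 'n::finite \<Rightarrow> real"
  assumes cont: "continuous_on (sphere 0 1) f" and nonneg: "\<And>u. norm u = 1 \<Longrightarrow> 0 \<le> f u"
  shows "\<exists>L\<in>star_bodies. \<forall>u\<in>sphere 0 1. radial L u = f u"
proof -
  let ?g = "\<lambda>(t, u). (t * f u) *\<^sub>R u"
  define L where "L = ?g ` ({0..1} \<times> sphere 0 1)"
  have "continuous_on ({0..1} \<times> sphere 0 1) ?g"
    unfolding split_def
    by (intro continuous_intros continuous_on_compose2[OF cont]) auto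
  then have cpt: "compact L"
    unfolding L_def by (intro compact_continuous_image compact_Times) auto
  obtain e :: "real ^ 'n" where "norm e = 1"
    using vector_choose_size[of 1] by auto
  then have zero: "0 \<in> L"
    unfolding L_def by (intro image_eqI[of _ _ "(0, e)"]) auto
  have star: "closed_segment 0 x \<subseteq> L" if x: "x \<in> L" for x
  proof
    fix y assume "y \<in> closed_segment 0 x"
    then obtain s where s: "0 \<le> s" "s \<le> 1" "y = s *\<^sub>R x"
      by (auto simp: in_segment)
    obtain t u where t: "0 \<le> t" "t \<le> 1" "norm u = 1" "x = (t * f u) *\<^sub>R u"
      using x by (auto simp: L_def)
    have "y = ?g (s * t, u)" "s * t \<in> {0..1}"
      using s t by (auto simp: mult_le_one)
    then show "y \<in> L"
      unfolding L_def using t by (intro image_eqI[of _ _ "(s * t, u)"]) auto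
  qed
  have rad: "radial L u = f u" if u: "norm u = 1" for u
  proof -
    have "{t. 0 \<le> t \<and> t *\<^sub>R u \<in> L} = {0..f u}"
    proof (intro set_eqI iffI)
      fix r assume "r \<in> {t. 0 \<le> t \<and> t *\<^sub>R u \<in> L}"
      then obtain t v where r: "0 \<le> r" and t: "0 \<le> t" "t \<le> 1" "norm v = 1"
        and eq: "r *\<^sub>R u = (t * f v) *\<^sub>R v"
        by (auto simp: L_def)
      have "norm (r *\<^sub>R u) = norm ((t * f v) *\<^sub>R v)"
        using eq by simp
      then have rt: "r = t * f v"
        using r t nonneg[OF t(3)] u by (simp add: abs_mult)
      have "r \<le> f u"
      proof (cases "r = 0")
        case True
        then show ?thesis using nonneg[OF u] by simp
      next
        case False
        then have "u = v" using eq rt by simp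
        then show ?thesis
          using rt t nonneg[OF t(3)] by (simp add: mult_left_le_one_le)
      qed
      then show "r \<in> {0..f u}" using r by simp
    next
      fix r assume r: "r \<in> {0..f u}"
      have "r *\<^sub>R u = ?g (r / f u, u)" "r / f u \<in> {0..1}"
        using r by (cases "f u = 0"; auto)+
      then have "r *\<^sub>R u \<in> L"
        unfolding L_def using u by (intro image_eqI[of _ _ "(r / f u, u)"]) auto
      then show "r \<in> {t. 0 \<le> t \<and> t *\<^sub>R u \<in> L}" using r by simp
    qed
    then show ?thesis
      unfolding radial_def using nonneg[OF u] by simp
  qed
  have "continuous_on (sphere 0 1) (radial L)"
    using cont by (rule continuous_on_eq) (simp add: rad)
  then have "L \<in> star_bodies"
    unfolding star_bodies_def using cpt zero star by auto
  then show ?thesis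
    using rad by (intro bexI[of _ L]) auto
qed

lemma star_body_ex1_power:
  fixes f :: "real ^ 'n::finite \<Rightarrow> real"
  assumes "continuous_on (sphere 0 1) f" "\<And>u. norm u = 1 \<Longrightarrow> 0 \<le> f u" "0 < k"
  shows "\<exists>!L. L \<in> star_bodies \<and> (\<forall>u\<in>sphere 0 1. radial L u ^ k = f u)"
proof -
  have nonneg: "0 \<le> radial L u" if "L \<in> star_bodies" "norm u = 1" for L and u :: "real ^ 'n"
  proof -
    have ray: "{t. 0 \<le> t \<and> t *\<^sub>R u \<in> L} = {0..radial L u}"
      using that by (intro radial_ray) (auto simp: star_bodies_def)
    have "0 \<in> {t. 0 \<le> t \<and> t *\<^sub>R u \<in> L}"
      using that by (simp add: star_bodies_def)
    then show ?thesis
      unfolding ray by simp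
  qed
  have "continuous_on (sphere 0 1) (\<lambda>u. root k (f u))"
    using assms by (intro continuous_intros)
  then obtain L where "L \<in> star_bodies" "\<forall>u\<in>sphere 0 1. radial L u = root k (f u)"
    using star_body_ex[of "\<lambda>u. root k (f u)"] assms by auto
  then have "L \<in> star_bodies \<and> (\<forall>u\<in>sphere 0 1. radial L u ^ k = f u)"
    using assms by simp
  moreover have "M = L" if "M \<in> star_bodies \<and> (\<forall>u\<in>sphere 0 1. radial M u ^ k = f u)"
    "L \<in> star_bodies \<and> (\<forall>u\<in>sphere 0 1. radial L u ^ k = f u)" for M L
  proof (rule star_body_eqI)
    fix u :: "real ^ 'n" assume u: "norm u = 1"
    then have "radial M u ^ k = radial L u ^ k"
      using that by simp
    then show "radial M u = radial L u"
      using nonneg[of M u] nonneg[of L u] that u assms(3)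
      by (intro power_eq_imp_eq_base[of "radial M u" k "radial L u"]) auto
  qed (use that in auto)
  ultimately show ?thesis by blast
qed

end

theory Submission
  imports Defs
begin

text \<open>Put \<open>n = CARD('n)\<close>. In terms of \<open>f = \<rho>(L)\<close> to the power \<open>n - 1\<close>, the map \<open>f \<mapsto> \<rho>(\<Psi> L)\<close> is an
  additive, hence monotone and positively homogeneous, operator \<open>T\<close> on nonnegative continuous
  functions. Let \<open>p\<close>, \<open>q\<close>
  be the radial functions of \<open>K\<close>, \<open>L\<close> and \<open>k = n - 2\<close>. Applying \<open>T\<close> to the arithmetic-geometric
  mean inequality for rescaled \<open>p\<close> and \<open>q\<close> bounds \<open>T (p ^ k * q)\<close> by a mean of multiples of
  \<open>T (p ^ (k + 1))\<close> and \<open>T (q ^ (k + 1))\<close>. The scaling is chosen such that these multiples have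
  equal volume, and convexity of the \<open>n\<close>-th power under the integral over the sphere gives the
  inequality. In the case of equality, \<open>T\<close> annihilates the nonnegative defect of the
  arithmetic-geometric mean inequality. Since rotations act transitively and the sphere is compact,
  a nontrivial \<open>T\<close> annihilates only \<open>0\<close>, so \<open>p\<close> and \<open>q\<close> are proportional.\<close>

subsection \<open>Elementary inequalities\<close>

text \<open>Weighted arithmetic-geometric mean inequality, by induction: after multiplying the
  inequality for \<open>k\<close> by \<open>y\<close>, what remains for \<open>Suc k\<close> is that
  \<open>real (Suc k) * x ^ k * (x - y)\<^sup>2\<close> is nonnegative.\<close>

lemma mean_power_ge:
  fixes x y :: real
  assumes "0 \<le> x" "0 \<le> y"
  shows "real (Suc k) * (x ^ k * y) \<le> real k * x ^ Suc k + y ^ Suc k"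
proof (induction k)
  case 0
  show ?case by simp
next
  case (Suc k)
  have "y * (real (Suc k) * (x ^ k * y)) \<le> y * (real k * x ^ Suc k + y ^ Suc k)"
    using Suc assms by (intro mult_left_mono)
  moreover have "0 \<le> real (Suc k) * x ^ k * (x - y)\<^sup>2"
    using assms by simp
  ultimately show ?case
    by (simp add: algebra_simps power2_eq_square)
qed

text \<open>Equality makes the square term of the induction above vanish, so \<open>x = 0\<close> or
  \<open>x = y\<close>; in the first case \<open>eq\<close> gives \<open>y = 0\<close>. For
  \<open>k = 0\<close> both sides are \<open>y\<close>, hence the assumption
  \<open>0 < k\<close>.\<close>

lemma mean_power_eq:
  fixes x y :: real
  assumes "0 \<le> x" "0 \<le> y" "0 < k"
    and eq: "real (Suc k) * (x ^ k * y) = real k * x ^ Suc k + y ^ Suc k"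
  shows "x = y"
proof -
  obtain j where j: "k = Suc j" using assms(3) by (cases k) auto
  have "y * (real (Suc j) * (x ^ j * y)) \<le> y * (real j * x ^ Suc j + y ^ Suc j)"
    using assms by (intro mult_left_mono mean_power_ge)
  then have "real (Suc j) * x ^ j * (x - y)\<^sup>2 \<le> 0"
    using eq unfolding j by (simp add: algebra_simps power2_eq_square)
  moreover have "0 \<le> real (Suc j) * x ^ j * (x - y)\<^sup>2"
    using assms by simp
  ultimately have "real (Suc j) * x ^ j * (x - y)\<^sup>2 = 0" by linarith
  then have "x = 0 \<or> x = y" by auto
  then show ?thesis using eq j by auto
qed

lemma mean_power_convex:
  fixes a b :: real
  assumes "0 \<le> a" "0 \<le> b"
  shows "((real k * a + b) / real (Suc k)) ^ n \<le> (real k * a ^ n + b ^ n) / real (Suc k)"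
proof -
  \<comment> \<open>Odd powers are convex on the half-line, even powers on the whole line.\<close>
  have "convex_on {0::real..} (\<lambda>x. x ^ n)"
    using convex_power_odd[of n] convex_on_subset[OF convex_power_even[of n]] by blast
  from convex_onD[OF this, of "1 / real (Suc k)" a b] assms
  have "((1 - 1 / real (Suc k)) * a + b / real (Suc k)) ^ n
      \<le> (1 - 1 / real (Suc k)) * a ^ n + b ^ n / real (Suc k)"
    by simp
  moreover have "1 - 1 / real (Suc k) = real k / real (Suc k)"
    by (simp add: field_simps)
  ultimately show ?thesis by (simp add: add_divide_distrib)
qed

subsection \<open>Star bodies and their radial functions\<close>

text \<open>Only values on the unit sphere count. Restricted to it, these are exactly the radial
  functions of star bodies.\<close>

definition nonneg_cont :: "(real ^ 'n::finite \<Rightarrow> real) set" where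
  "nonneg_cont = {f. continuous_on (sphere 0 1) f \<and> (\<forall>u\<in>sphere 0 1. 0 \<le> f u)}"

lemma nonneg_contI:
  assumes "continuous_on (sphere 0 1) f" "\<And>u. norm u = 1 \<Longrightarrow> 0 \<le> f u"
  shows "f \<in> nonneg_cont"
  using assms by (simp add: nonneg_cont_def)

lemma nonneg_contD:
  assumes "f \<in> nonneg_cont"
  shows "continuous_on (sphere 0 1) f" "norm u = 1 \<Longrightarrow> 0 \<le> f u"
  using assms by (simp_all add: nonneg_cont_def)

lemma nonneg_cont_cong:
  assumes f: "f \<in> nonneg_cont" and eq: "\<And>u. norm u = 1 \<Longrightarrow> f u = g u"
  shows "g \<in> nonneg_cont"
proof (rule nonneg_contI)
  show "continuous_on (sphere 0 1) g"
    using nonneg_contD(1)[OF f] by (rule continuous_on_eq) (simp add: eq)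
  show "0 \<le> g u" if "norm u = 1" for u
    using nonneg_contD(2)[OF f that] eq[OF that] by simp
qed

lemma nonneg_cont_add:
  "f \<in> nonneg_cont \<Longrightarrow> g \<in> nonneg_cont \<Longrightarrow> (\<lambda>u. f u + g u) \<in> nonneg_cont"
  by (simp add: nonneg_cont_def continuous_on_add)

lemma nonneg_cont_mult:
  "f \<in> nonneg_cont \<Longrightarrow> g \<in> nonneg_cont \<Longrightarrow> (\<lambda>u. f u * g u) \<in> nonneg_cont"
  by (simp add: nonneg_cont_def continuous_on_mult)

lemma nonneg_cont_power:
  "f \<in> nonneg_cont \<Longrightarrow> (\<lambda>u. f u ^ k) \<in> nonneg_cont"
  by (simp add: nonneg_cont_def continuous_on_power)

lemma nonneg_cont_const: "0 \<le> c \<Longrightarrow> (\<lambda>u. c) \<in> nonneg_cont"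
  by (simp add: nonneg_cont_def)

lemma nonneg_cont_cmult:
  "0 \<le> c \<Longrightarrow> f \<in> nonneg_cont \<Longrightarrow> (\<lambda>u. c * f u) \<in> nonneg_cont"
  by (rule nonneg_cont_mult[OF nonneg_cont_const])

lemma nonneg_cont_sum:
  "(\<And>a. a \<in> A \<Longrightarrow> f a \<in> nonneg_cont) \<Longrightarrow> (\<lambda>u. \<Sum>a\<in>A. f a u) \<in> nonneg_cont"
  by (simp add: nonneg_cont_def continuous_on_sum sum_nonneg)

lemma nonneg_cont_diff:
  assumes "f \<in> nonneg_cont" "g \<in> nonneg_cont" "\<And>u. norm u = 1 \<Longrightarrow> f u \<le> g u"
  shows "(\<lambda>u. g u - f u) \<in> nonneg_cont"
  using assms by (simp add: nonneg_cont_def continuous_on_diff)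

section \<open>Radial functions of star bodies\<close>

lemma star_body_ray:
  assumes "M \<in> star_bodies" "norm u = 1"
  shows "0 \<le> t \<and> t *\<^sub>R u \<in> M \<longleftrightarrow> 0 \<le> t \<and> t \<le> radial M u"
proof -
  have "{t. 0 \<le> t \<and> t *\<^sub>R u \<in> M} = {0..radial M u}"
    using assms by (intro radial_ray) (auto simp: star_bodies_def)
  then have "t \<in> {t. 0 \<le> t \<and> t *\<^sub>R u \<in> M} \<longleftrightarrow> t \<in> {0..radial M u}"
    by (rule arg_cong)
  then show ?thesis by simp
qed

lemma radial_nonneg: "M \<in> star_bodies \<Longrightarrow> norm u = 1 \<Longrightarrow> 0 \<le> radial M u"
  using star_body_ray[of M u 0] by (simp add: star_bodies_def)

lemma radial_nonneg_cont: "M \<in> star_bodies \<Longrightarrow> radial M \<in> nonneg_cont"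
  by (simp add: nonneg_cont_def radial_nonneg) (simp add: star_bodies_def)

lemma star_body_zero: "{0} \<in> star_bodies" and radial_zero: "norm u = 1 \<Longrightarrow> radial {0} u = 0"
proof -
  have r: "radial {0} u = 0" if "norm u = 1" for u :: "real ^ 'n"
  proof -
    have "{t. 0 \<le> t \<and> t *\<^sub>R u \<in> {0}} = {0}" using that by auto
    then show ?thesis by (simp add: radial_def)
  qed
  then show "norm u = 1 \<Longrightarrow> radial {0} u = 0" for u :: "real ^ 'n" .
  have "continuous_on (sphere 0 1) (radial {0::real ^ 'n})"
    by (rule continuous_on_eq[of _ "\<lambda>_. 0"]) (simp_all add: r)
  then show "{0::real ^ 'n} \<in> star_bodies"
    by (simp add: star_bodies_def)
qed

lemma star_body_eq_zero_iff:
  assumes "M \<in> star_bodies"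
  shows "M = {0} \<longleftrightarrow> (\<forall>u\<in>sphere 0 1. radial M u = 0)"
proof
  show "M = {0}" if "\<forall>u\<in>sphere 0 1. radial M u = 0"
    using assms star_body_zero by (rule star_body_eqI) (use that in \<open>simp add: radial_zero\<close>)
qed (simp add: radial_zero)

text \<open>The common form of the definite descriptions: \<open>k = n - 1\<close> serves the radial
  Blaschke sum and the body inside \<open>mixed\<close>, \<open>k = 1\<close> the radial Minkowski
  sum.\<close>

definition power_body :: "nat \<Rightarrow> (real ^ 'n::finite \<Rightarrow> real) \<Rightarrow> (real ^ 'n) set" where
  "power_body k f =
     (THE M. M \<in> star_bodies \<and> (\<forall>u\<in>sphere 0 1. radial M u ^ k = f u))"

lemma power_body_cong:
  assumes "\<And>u. norm u = 1 \<Longrightarrow> f u = g u"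
  shows "power_body k f = power_body k g"
  using assms by (simp add: power_body_def)

lemma power_body:
  assumes "f \<in> nonneg_cont" "0 < k"
  shows power_body_star: "power_body k f \<in> star_bodies"
    and radial_power_body: "norm u = 1 \<Longrightarrow> radial (power_body k f) u ^ k = f u"
  using theI'[OF star_body_ex1_power[of f k]] assms
  by (auto simp: nonneg_cont_def power_body_def)

lemma power_body_eqI:
  assumes "M \<in> star_bodies" "\<And>u. norm u = 1 \<Longrightarrow> radial M u ^ k = f u" "0 < k"
  shows "power_body k f = M"
proof -
  have "f \<in> nonneg_cont"
    using nonneg_cont_power[OF radial_nonneg_cont[OF assms(1)], of k] assms(2)
    by (rule nonneg_cont_cong)
  then have "\<exists>!L. L \<in> star_bodies \<and> (\<forall>u\<in>sphere 0 1. radial L u ^ k = f u)"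
    using assms(3) by (intro star_body_ex1_power) (auto simp: nonneg_cont_def)
  then show ?thesis
    unfolding power_body_def by (rule the1_equality) (use assms in auto)
qed

text \<open>Since \<open>Q\<close> is linear with inverse \<open>R\<close>, a multiple
  \<open>t *\<^sub>R u\<close> lies in the image exactly when \<open>(t / c) *\<^sub>R R u\<close>
  lies in \<open>M\<close>. The identity as \<open>Q\<close> covers dilates, \<open>c = 1\<close>
  covers rotations.\<close>

lemma star_body_image:
  fixes Q :: "real ^ 'n::finite \<Rightarrow> real ^ 'n"
  assumes M: "M \<in> star_bodies" and Q: "orthogonal_transformation Q" and R: "\<And>x. Q (R x) = x"
    and c: "0 < c"
  shows star_body_image_star: "(\<lambda>x. c *\<^sub>R Q x) ` M \<in> star_bodies"
    and radial_image: "norm u = 1 \<Longrightarrow> radial ((\<lambda>x. c *\<^sub>R Q x) ` M) u = c * radial M (R u)"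
proof -
  let ?P = "\<lambda>x. c *\<^sub>R Q x"
  have lin: "linear Q" using Q by (rule orthogonal_transformation_linear)
  have linP: "linear ?P" using lin by (rule linear_compose_scale_right)
  have inj: "inj Q" using Q by (rule orthogonal_transformation_inj)
  have nR: "norm (R x) = norm x" for x
    using orthogonal_transformation_norm[OF Q, of "R x"] R by simp
  have R_eq: "R = inv Q"
    using R inj by (metis inv_f_eq ext)
  have linR: "linear R"
    unfolding R_eq using orthogonal_transformation_inv[OF Q] by (rule orthogonal_transformation_linear)
  have mem: "t *\<^sub>R u \<in> ?P ` M \<longleftrightarrow> (t / c) *\<^sub>R R u \<in> M" for t u
  proof -
    have "?P ((t / c) *\<^sub>R R u) = t *\<^sub>R u"
      using c R by (simp add: linear_scale[OF lin])
    moreover have "inj ?P"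
      using inj c by (auto simp: inj_def)
    ultimately show ?thesis by (metis inj_image_mem_iff)
  qed
  have rad: "radial (?P ` M) u = c * radial M (R u)" if u: "norm u = 1" for u
  proof -
    have "{t. 0 \<le> t \<and> t *\<^sub>R u \<in> ?P ` M} = {0..c * radial M (R u)}"
      unfolding mem using star_body_ray[OF M, of "R u"] nR u c
      by (auto simp: field_simps set_eq_iff) (metis divide_nonneg_pos mult.commute pos_divide_le_eq)+
    then show ?thesis
      using radial_nonneg[OF M, of "R u"] nR u c by (simp add: radial_def)
  qed
  then show "norm u = 1 \<Longrightarrow> radial (?P ` M) u = c * radial M (R u)" for u .
  have "continuous_on (sphere 0 1) (radial M)"
    using M by (simp add: star_bodies_def)
  moreover have "continuous_on (sphere 0 1) R"
    using linR by (simp add: linear_continuous_on linear_linear)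
  ultimately have "continuous_on (sphere 0 1) (\<lambda>u. radial M (R u))"
    by (rule continuous_on_compose2) (auto simp: nR)
  then have "continuous_on (sphere 0 1) (\<lambda>u. c * radial M (R u))"
    by (intro continuous_on_mult_left)
  then have "continuous_on (sphere 0 1) (radial (?P ` M))"
    by (rule continuous_on_eq) (simp add: rad)
  moreover have "compact (?P ` M)"
    using M linP by (intro compact_continuous_image linear_continuous_on) (auto simp: star_bodies_def linear_linear)
  moreover have "0 \<in> ?P ` M"
    using M linear_0[OF linP] by (auto simp: star_bodies_def intro!: image_eqI[of _ _ 0])
  moreover have "closed_segment 0 x \<subseteq> ?P ` M" if x: "x \<in> ?P ` M" for x
  proof -
    obtain y where y: "y \<in> M" "x = ?P y" using x by blast
    then have "closed_segment 0 x = ?P ` closed_segment 0 y"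
      using closed_segment_linear_image[OF linP, of 0 y] linear_0[OF linP] by simp
    moreover have "closed_segment 0 y \<subseteq> M"
      using y M by (simp add: star_bodies_def)
    ultimately show ?thesis by (simp add: image_mono)
  qed
  ultimately show "?P ` M \<in> star_bodies"
    by (simp add: star_bodies_def)
qed

lemma dilates_iff_radial:
  fixes K L :: "(real ^ 'n::finite) set"
  assumes "K \<in> star_bodies" "L \<in> star_bodies"
  shows "dilates K L \<longleftrightarrow> (\<exists>c>0. \<forall>u\<in>sphere 0 1. radial K u = c * radial L u)"
proof -
  have "K = (*\<^sub>R) c ` L \<longleftrightarrow> (\<forall>u\<in>sphere 0 1. radial K u = c * radial L u)" if "0 < c" for c
    using star_body_image[OF assms(2) orthogonal_transformation_id, where R = "\<lambda>x. x" and c = c] that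
      star_body_eqI[OF assms(1), of "(*\<^sub>R) c ` L"] by auto
  then show ?thesis unfolding dilates_def by blast
qed

subsection \<open>Volume in polar coordinates\<close>

text \<open>The shell stands in for the sphere: functions of the direction \<open>sgn y\<close> are
  integrated over it by Lebesgue measure, so that no surface measure enters.\<close>

definition shell :: "'a::real_normed_vector set" where
  "shell = {y. 1 \<le> norm y \<and> norm y \<le> 2}"

text \<open>The exponent is the one that integration over scales produces in
  \<open>emeasure_star_body\<close>: \<open>n\<close> factors \<open>1 / norm y\<close> come from
  the rescaled radial function, one from the normalisation \<open>2 / norm x\<close>.\<close>

definition shell_weight :: "real ^ 'n::finite \<Rightarrow> real" where
  "shell_weight y = 2 / (real CARD('n) * norm y ^ Suc CARD('n))"

text \<open>Since \<open>shell_weight\<close> has radial integral \<open>1 / n\<close> over \<open>shell\<close>, this is \<open>1 / n\<close> times the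
  integral against surface measure.\<close>

definition sphere_integral :: "(real ^ 'n::finite \<Rightarrow> real) \<Rightarrow> real" where
  "sphere_integral f =
     (LINT y:shell|lborel. f (sgn y) * shell_weight y)"

lemma compact_shell: "compact (shell :: 'a::euclidean_space set)"
proof -
  have eq: "shell = cball 0 2 - ball (0::'a) 1"
    by (auto simp: shell_def)
  show ?thesis unfolding eq by (intro compact_diff compact_cball open_ball)
qed

lemma norm_sgn_shell: "y \<in> shell \<Longrightarrow> norm (sgn y) = 1"
  by (auto simp: shell_def norm_sgn)

lemma continuous_on_sgn_comp:
  assumes "continuous_on (sphere 0 1) f" "0 \<notin> S"
  shows "continuous_on S (\<lambda>y::real ^ 'n::finite. f (sgn y))"
proof -
  have "continuous_on S (\<lambda>y::real ^ 'n. sgn y)"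
    using assms(2) by (intro continuous_on_sgn continuous_on_id) auto
  then show ?thesis
    using assms by (intro continuous_on_compose2[OF assms(1)]) (auto simp: norm_sgn)
qed

lemma shell_weight_nonneg: "0 \<le> shell_weight y"
  by (simp add: shell_weight_def)

lemma sphere_integrable:
  fixes f :: "real ^ 'n::finite \<Rightarrow> real"
  assumes "continuous_on (sphere 0 1) f"
  shows "set_integrable lborel shell
    (\<lambda>y. f (sgn y) * shell_weight y)"
proof -
  have "continuous_on shell (\<lambda>y::real ^ 'n. f (sgn y))"
    using assms by (rule continuous_on_sgn_comp) (simp add: shell_def)
  moreover have "continuous_on shell (shell_weight :: real ^ 'n \<Rightarrow> real)"
    unfolding shell_weight_def by (intro continuous_intros) (auto simp: shell_def)
  ultimately show ?thesis
    unfolding set_integrable_def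
    by (intro borel_integrable_compact compact_shell continuous_on_mult)
qed

lemma sphere_integral_lincomb:
  assumes "continuous_on (sphere 0 1) f" "continuous_on (sphere 0 1) g"
  shows "sphere_integral (\<lambda>u. a * f u + b * g u) = a * sphere_integral f + b * sphere_integral g"
proof -
  have "sphere_integral (\<lambda>u. a * f u + b * g u) =
    (LINT y:shell|lborel. a * (f (sgn y) * shell_weight y)
       + b * (g (sgn y) * shell_weight y))"
    unfolding sphere_integral_def by (simp add: distrib_right mult.assoc)
  also have "\<dots> = a * sphere_integral f + b * sphere_integral g"
    using assms unfolding sphere_integral_def
    by (subst set_integral_add) (auto intro!: set_integrable_mult_right sphere_integrable)
  finally show ?thesis .
qed

lemma sphere_integral_mono:
  assumes "continuous_on (sphere 0 1) f" "continuous_on (sphere 0 1) g"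
    and le: "\<And>u. norm u = 1 \<Longrightarrow> f u \<le> g u"
  shows "sphere_integral f \<le> sphere_integral g"
  unfolding sphere_integral_def
  by (intro set_integral_mono sphere_integrable assms mult_right_mono le)
    (simp_all add: norm_sgn_shell shell_weight_nonneg)

text \<open>If \<open>f\<close> and \<open>g\<close> differed at \<open>u\<close>, then by
  continuity they would differ in all directions of a nonempty open subset of the shell, which is
  not a null set. But the difference is nonnegative with integral zero.\<close>

lemma sphere_integral_eq_imp_eq:
  fixes f g :: "real ^ 'n::finite \<Rightarrow> real"
  assumes f: "continuous_on (sphere 0 1) f" and g: "continuous_on (sphere 0 1) g"
    and le: "\<And>u. norm u = 1 \<Longrightarrow> f u \<le> g u"
    and eq: "sphere_integral f = sphere_integral g" and u: "norm u = 1"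
  shows "f u = g u"
proof (rule ccontr)
  assume neq: "f u \<noteq> g u"
  define d where "d y = indicator shell y *\<^sub>R ((g (sgn y) - f (sgn y)) * shell_weight y)" for y :: "real ^ 'n"
  have gf: "continuous_on (sphere 0 1) (\<lambda>u. g u - f u)"
    using f g by (rule continuous_on_diff[rotated])
  have int: "integrable lborel d"
    using sphere_integrable[OF gf] unfolding d_def set_integrable_def .
  have "integral\<^sup>L lborel d = sphere_integral (\<lambda>u. 1 * g u + (- 1) * f u)"
    by (simp add: sphere_integral_def d_def[abs_def] set_lebesgue_integral_def)
  also have "\<dots> = 0"
    unfolding sphere_integral_lincomb[OF g f] using eq by simp
  finally have "integral\<^sup>L lborel d = 0" .
  moreover have "0 \<le> d y" for y
    using le[of "sgn y"] by (auto simp: d_def indicator_def norm_sgn_shell shell_weight_nonneg)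
  ultimately have "AE y in lborel. d y = 0"
    using integral_nonneg_eq_0_iff_AE[OF int] by simp
  then have ae: "AE y in lebesgue. d y = 0"
    by (rule AE_completion)
  \<comment> \<open>The boundary of the shell is removed to make this set open;
    \<open>(3/2) *\<^sub>R u\<close> will be its point in direction \<open>u\<close>.\<close>
  define O' where "O' = {y. 1 < norm y \<and> norm y < 2} \<inter> {y::real ^ 'n. g (sgn y) - f (sgn y) \<noteq> 0}"
  have "continuous_on {y::real ^ 'n. 1 < norm y \<and> norm y < 2} (\<lambda>y. g (sgn y) - f (sgn y))"
    using gf by (rule continuous_on_sgn_comp) simp
  moreover have "open {y::real ^ 'n. 1 < norm y \<and> norm y < 2}"
    by (intro open_Collect_conj open_Collect_less continuous_intros)
  ultimately have "open ({y. 1 < norm y \<and> norm y < 2} \<inter> (\<lambda>y. g (sgn y) - f (sgn y)) -` (- {0}))"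
    by (intro continuous_open_preimage) auto
  then have "open O'"
    by (simp add: O'_def vimage_def)
  moreover have "(3/2) *\<^sub>R u \<in> O'"
    using u neq by (simp add: O'_def sgn_div_norm)
  ultimately have "\<not> negligible O'"
    using open_not_negligible by blast
  moreover have nz: "d y \<noteq> 0" if "y \<in> O'" for y
    using that by (auto simp: O'_def d_def shell_def shell_weight_def)
  have "AE y in lebesgue. y \<notin> O'"
    using ae by (rule eventually_mono) (use nz in blast)
  then have "negligible O'"
    using \<open>open O'\<close> by (simp add: negligible_iff_null_sets AE_iff_null_sets lborelD)
  ultimately show False by simp
qed

text \<open>Polar coordinates by Fubini: spread the indicator function of \<open>M\<close> over the scales \<open>t\<close> with
  \<open>t \<le> norm x \<le> 2 * t\<close>, substitute \<open>x = t y\<close>, so that \<open>y\<close> ranges over \<open>shell\<close>, and integrate over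
  \<open>t\<close> first.\<close>

lemma emeasure_star_body:
  fixes M :: "(real ^ 'n::finite) set"
  assumes M: "M \<in> star_bodies"
  shows "emeasure lborel M =
    (\<integral>\<^sup>+ y. indicator shell y *
       ennreal (radial M (sgn y) ^ CARD('n) * shell_weight y) \<partial>lborel)"
proof -
  define n where "n = CARD('n)"
  have n: "0 < n" by (simp add: n_def)
  have Mb[measurable]: "M \<in> sets borel"
    using M by (auto simp: star_bodies_def intro: borel_compact)
  \<comment> \<open>For \<open>x \<noteq> 0\<close> the admissible scales \<open>t\<close> form the
    interval from \<open>norm x / 2\<close> to \<open>norm x\<close>; the factor
    \<open>2 / norm x\<close> normalises its length to one.\<close>
  define g :: "real \<Rightarrow> real ^ 'n \<Rightarrow> ennreal" where
    "g t x = (if x \<in> M \<and> t \<le> norm x \<and> norm x \<le> 2 * t then ennreal (2 / norm x) else 0)" for t x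
  \<comment> \<open>The integrand after the substitution \<open>x = t y\<close>, with Jacobian
    \<open>t ^ n\<close>.\<close>
  define h :: "real \<Rightarrow> real ^ 'n \<Rightarrow> ennreal" where
    "h t y = (if 0 < t then ennreal (t ^ n) * g t (t *\<^sub>R y) else 0)" for t y
  have gm: "case_prod g \<in> borel_measurable (lborel \<Otimes>\<^sub>M lborel)"
    unfolding g_def split_def by measurable
  have gt: "g t \<in> borel_measurable borel" for t
    unfolding g_def by measurable
  have hm: "case_prod h \<in> borel_measurable (lborel \<Otimes>\<^sub>M lborel)"
    unfolding h_def g_def split_def by measurable
  have one: "(\<integral>\<^sup>+ t. g t x \<partial>lborel) = indicator M x" if "x \<noteq> 0" for x
  proof -
    have "g t x = ennreal (2 / norm x) * indicator M x * indicator {norm x / 2..norm x} t" for t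
      by (auto simp: g_def indicator_def)
    then have "(\<integral>\<^sup>+ t. g t x \<partial>lborel) = ennreal (2 / norm x) * indicator M x * ennreal (norm x / 2)"
      by (simp add: nn_integral_cmult_indicator)
    also have "\<dots> = indicator M x"
      using that by (simp add: indicator_def ennreal_mult[symmetric])
    finally show ?thesis .
  qed
  have scale: "(\<integral>\<^sup>+ x. g t x \<partial>lborel) = (\<integral>\<^sup>+ y. h t y \<partial>lborel)" for t
  proof (cases "0 < t")
    case True
    have "(\<integral>\<^sup>+ x. g t x \<partial>lborel)
        = (\<integral>\<^sup>+ x. g t x \<partial>density (distr lborel borel (\<lambda>x. 0 + t *\<^sub>R x)) (\<lambda>_. ennreal (\<bar>t\<bar> ^ DIM(real ^ 'n))))"
      using True by (subst lborel_affine[of t 0]) (use gt in auto)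
    also have "\<dots> = (\<integral>\<^sup>+ x. ennreal (t ^ n) * g t x \<partial>distr lborel borel (\<lambda>x. 0 + t *\<^sub>R x))"
      using True by (subst nn_integral_density) (use gt in \<open>auto simp: n_def\<close>)
    also have "\<dots> = (\<integral>\<^sup>+ y. ennreal (t ^ n) * g t (t *\<^sub>R y) \<partial>lborel)"
      by (subst nn_integral_distr) (use gt in auto)
    finally show ?thesis using True by (simp add: h_def)
  next
    \<comment> \<open>For \<open>t \<le> 0\<close> at most \<open>x = 0\<close> meets the
      constraints, and there \<open>2 / norm x\<close> is \<open>0\<close> by the convention on
      division by zero.\<close>
    case False
    have "g t x = 0" for x
    proof (cases "x = 0")
      case True
      then show ?thesis by (simp add: g_def)
    next
      case x: False
      then have "0 < norm x" by simp
      with \<open>\<not> 0 < t\<close> have "\<not> norm x \<le> 2 * t" by linarith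
      then show ?thesis by (simp add: g_def)
    qed
    with False show ?thesis by (simp add: h_def)
  qed
  have inner: "(\<integral>\<^sup>+ t. h t y \<partial>lborel)
      = indicator shell y * ennreal (radial M (sgn y) ^ n * shell_weight y)" for y
  proof (cases "y \<in> shell")
    case True
    then have y: "0 < norm y" "y \<noteq> 0" by (auto simp: shell_def)
    have u: "norm (sgn y) = 1" using y by (simp add: norm_sgn)
    \<comment> \<open>The ray through \<open>y\<close>, measured in multiples of \<open>y\<close>,
      leaves \<open>M\<close> at \<open>r\<close>.\<close>
    define r where "r = radial M (sgn y) / norm y"
    have r: "0 \<le> r" using radial_nonneg[OF M u] by (simp add: r_def)
    have mem: "t *\<^sub>R y \<in> M \<longleftrightarrow> t \<le> r" if "0 < t" for t
    proof -
      have "t *\<^sub>R y = (t * norm y) *\<^sub>R sgn y"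
        using y by (simp add: sgn_div_norm)
      then show ?thesis
        using star_body_ray[OF M u, of "t * norm y"] that y by (simp add: r_def pos_le_divide_eq)
    qed
    \<comment> \<open>At \<open>t = 0\<close> the left side is \<open>0\<close>, but
      \<open>0 ^ (n - 1)\<close> is \<open>1\<close> when \<open>n = 1\<close>.\<close>
    have h: "h t y = ennreal (t ^ (n - 1) * (2 / norm y)) * indicator {0..r} t" if "t \<noteq> 0" for t
    proof (cases "0 < t")
      case True
      have "t ^ n = t ^ (n - 1) * t"
        using n by (metis power_minus_mult)
      moreover have "t \<le> t * norm y" "t * norm y \<le> 2 * t"
        using \<open>y \<in> shell\<close> True by (auto simp: shell_def)
      ultimately show ?thesis
        using True y mem[OF True] by (simp add: h_def g_def ennreal_mult[symmetric] field_simps)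
    qed (use that in \<open>simp add: h_def\<close>)
    have "(\<integral>\<^sup>+ t. h t y \<partial>lborel)
        = (\<integral>\<^sup>+ t. ennreal (t ^ (n - 1) * (2 / norm y)) * indicator {0..r} t \<partial>lborel)"
      using h by (intro nn_integral_cong_AE eventually_mono[OF AE_lborel_singleton[of 0]])
    also have "\<dots> = ennreal (r ^ n * (2 / norm y) / n - 0 ^ n * (2 / norm y) / n)"
    proof (rule nn_integral_FTC_Icc)
      show "((\<lambda>t. t ^ n * (2 / norm y) / n) has_real_derivative t ^ (n - 1) * (2 / norm y))
          (at t)" for t
        using n y by (auto intro!: derivative_eq_intros)
    qed (use r y in auto)
    also have "r ^ n * (2 / norm y) / n - 0 ^ n * (2 / norm y) / n
        = radial M (sgn y) ^ n * shell_weight y"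
      using n by (simp add: r_def shell_weight_def n_def[symmetric] power_divide field_simps)
    finally show ?thesis using True by simp
  next
    case False
    have "h t y = 0" for t
    proof (cases "0 < t")
      case True
      then have "\<not> (t \<le> t * norm y \<and> t * norm y \<le> 2 * t)"
        using False by (simp add: shell_def)
      then show ?thesis using True by (auto simp: h_def g_def)
    qed (simp add: h_def)
    with False show ?thesis by simp
  qed
  have "emeasure lborel M = (\<integral>\<^sup>+ x. indicator M x \<partial>lborel)"
    by simp
  \<comment> \<open>The identity \<open>one\<close> fails at the origin, which is a null
    set.\<close>
  also have "\<dots> = (\<integral>\<^sup>+ x. (\<integral>\<^sup>+ t. g t x \<partial>lborel) \<partial>lborel)"
    using one by (intro nn_integral_cong_AE eventually_mono[OF AE_lborel_singleton[of 0]]) simp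
  also have "\<dots> = (\<integral>\<^sup>+ t. (\<integral>\<^sup>+ x. g t x \<partial>lborel) \<partial>lborel)"
    using gm by (rule lborel_pair.Fubini')
  also have "\<dots> = (\<integral>\<^sup>+ t. (\<integral>\<^sup>+ y. h t y \<partial>lborel) \<partial>lborel)"
    by (simp only: scale)
  also have "\<dots> = (\<integral>\<^sup>+ y. (\<integral>\<^sup>+ t. h t y \<partial>lborel) \<partial>lborel)"
    using hm by (rule lborel_pair.Fubini'[symmetric])
  finally show ?thesis
    by (simp only: inner n_def)
qed

lemma volume_star_body:
  fixes M :: "(real ^ 'n::finite) set"
  assumes M: "M \<in> star_bodies"
  shows "volume M = sphere_integral (\<lambda>u. radial M u ^ CARD('n))"
proof -
  let ?f = "\<lambda>y. radial M (sgn y) ^ CARD('n) * shell_weight y"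
  have Mb: "M \<in> sets borel"
    using M by (auto simp: star_bodies_def intro: borel_compact)
  have int: "integrable lborel (\<lambda>y. indicator shell y *\<^sub>R ?f y)"
    using sphere_integrable[OF nonneg_contD(1)[OF nonneg_cont_power[OF radial_nonneg_cont[OF M]]]]
    by (simp add: set_integrable_def)
  have nonneg: "0 \<le> indicator shell y *\<^sub>R ?f y" for y
    using radial_nonneg[OF M, of "sgn y"]
    by (auto simp: indicator_def norm_sgn_shell shell_weight_nonneg)
  have "emeasure lborel M = (\<integral>\<^sup>+ y. ennreal (indicator shell y *\<^sub>R ?f y) \<partial>lborel)"
    unfolding emeasure_star_body[OF M] by (intro nn_integral_cong) (simp add: indicator_def)
  also have "\<dots> = ennreal (sphere_integral (\<lambda>u. radial M u ^ CARD('n)))"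
    using nn_integral_eq_integral[OF int] nonneg
    by (simp add: sphere_integral_def set_lebesgue_integral_def)
  finally have "measure lborel M = sphere_integral (\<lambda>u. radial M u ^ CARD('n))"
    using integral_nonneg_AE[of "\<lambda>y. indicator shell y *\<^sub>R ?f y" lborel] nonneg
    by (simp add: measure_def sphere_integral_def set_lebesgue_integral_def)
  with Mb show ?thesis by (simp add: measure_completion)
qed

subsection \<open>The operator on radial functions\<close>

text \<open>Cauchy's functional equation: additivity and nonnegativity make \<phi> monotone. For
  every \<open>N\<close>, an integer \<open>k\<close> with \<open>k \<le> N c \<le> k + 1\<close>
  then bounds \<open>N\<close> times the discrepancy by \<open>\<phi> 1\<close>, so the discrepancy
  is zero.\<close>

lemma additive_nonneg_linear:
  fixes \<phi> :: "real \<Rightarrow> real"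
  assumes add: "\<And>a b. 0 \<le> a \<Longrightarrow> 0 \<le> b \<Longrightarrow> \<phi> (a + b) = \<phi> a + \<phi> b"
    and nonneg: "\<And>a. 0 \<le> a \<Longrightarrow> 0 \<le> \<phi> a" and c: "0 \<le> c"
  shows "\<phi> c = c * \<phi> 1"
proof (rule ccontr)
  assume neq: "\<phi> c \<noteq> c * \<phi> 1"
  have mono: "\<phi> a \<le> \<phi> b" if "0 \<le> a" "a \<le> b" for a b
    using add[of a "b - a"] nonneg[of "b - a"] that by simp
  have zero: "\<phi> 0 = 0" using add[of 0 0] by simp
  have mult: "\<phi> (real k * a) = real k * \<phi> a" if "0 \<le> a" for k a
  proof (induction k)
    case (Suc k)
    then show ?case
      using add[of a "real k * a"] that by (simp add: algebra_simps)
  qed (simp add: zero)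
  obtain N :: nat where N: "\<phi> 1 < real N * \<bar>\<phi> c - c * \<phi> 1\<bar>"
    using reals_Archimedean3[of "\<bar>\<phi> c - c * \<phi> 1\<bar>"] neq by auto
  define k where "k = nat \<lfloor>real N * c\<rfloor>"
  have k: "real k \<le> real N * c" "real N * c \<le> real (Suc k)"
    using c by (auto simp: k_def) linarith
  have "real k * \<phi> 1 \<le> real N * \<phi> c"
    using mono[OF _ k(1)] mult[OF c, of N] mult[of 1 k] by simp
  moreover have "real N * \<phi> c \<le> real (Suc k) * \<phi> 1"
    using mono[OF _ k(2)] mult[OF c, of N] mult[of 1 "Suc k"] c by simp
  moreover have "real k * \<phi> 1 \<le> real N * c * \<phi> 1" "real N * c * \<phi> 1 \<le> real (Suc k) * \<phi> 1"
    using k nonneg[of 1] by (auto intro: mult_right_mono simp del: of_nat_Suc)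
  ultimately have "\<bar>real N * \<phi> c - real N * c * \<phi> 1\<bar> \<le> \<phi> 1"
    by (auto simp: algebra_simps abs_le_iff)
  also have "real N * \<phi> c - real N * c * \<phi> 1 = real N * (\<phi> c - c * \<phi> 1)"
    by (simp add: algebra_simps)
  finally show False
    using N by (simp add: abs_mult)
qed

text \<open>With the dimension written as \<open>Suc (Suc k)\<close>, the exponents
  \<open>n - 1\<close> and \<open>n - 2\<close> become \<open>Suc k\<close> and \<open>k\<close>,
  without truncated subtraction.\<close>

locale nontrivial_hom =
  fixes \<Psi> :: "(real ^ 'n::finite) set \<Rightarrow> (real ^ 'n) set" and k :: nat
  assumes card: "CARD('n) = Suc (Suc k)" and k_pos: "0 < k"
    and hom: "radial_Blaschke_Minkowski_hom \<Psi>"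
    and nontrivial: "\<not> trivial_hom \<Psi>"
begin

definition T :: "(real ^ 'n \<Rightarrow> real) \<Rightarrow> real ^ 'n \<Rightarrow> real" where
  "T f = radial (\<Psi> (power_body (Suc k) f))"

lemma hom_star: "M \<in> star_bodies \<Longrightarrow> \<Psi> M \<in> star_bodies"
  using hom by (auto simp: radial_Blaschke_Minkowski_hom_def)

lemma T_nonneg_cont: "f \<in> nonneg_cont \<Longrightarrow> T f \<in> nonneg_cont"
  unfolding T_def by (intro radial_nonneg_cont hom_star power_body_star zero_less_Suc)

lemma T_nonneg: "f \<in> nonneg_cont \<Longrightarrow> norm u = 1 \<Longrightarrow> 0 \<le> T f u"
  by (rule nonneg_contD(2)[OF T_nonneg_cont])

lemma T_cong: "(\<And>u. norm u = 1 \<Longrightarrow> f u = g u) \<Longrightarrow> T f = T g"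
  unfolding T_def by (simp add: power_body_cong[of f g])

lemma radial_hom:
  "M \<in> star_bodies \<Longrightarrow> radial (\<Psi> M) = T (\<lambda>u. radial M u ^ Suc k)"
  unfolding T_def by (simp only: power_body_eqI[OF _ refl zero_less_Suc])

text \<open>The radial Blaschke sum adds the powers that \<open>T\<close> takes as arguments, and
  the radial Minkowski sum adds its values.\<close>

lemma T_add:
  assumes f: "f \<in> nonneg_cont" and g: "g \<in> nonneg_cont" and u: "norm u = 1"
  shows "T (\<lambda>u. f u + g u) u = T f u + T g u"
proof -
  let ?K = "power_body (Suc k) f" and ?L = "power_body (Suc k) g"
  have K: "?K \<in> star_bodies" "\<And>u. norm u = 1 \<Longrightarrow> radial ?K u ^ (Suc k) = f u"
    using power_body[OF f zero_less_Suc] by auto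
  have L: "?L \<in> star_bodies" "\<And>u. norm u = 1 \<Longrightarrow> radial ?L u ^ (Suc k) = g u"
    using power_body[OF g zero_less_Suc] by auto
  have "power_body (Suc k) (\<lambda>u. f u + g u) = radial_Blaschke_sum ?K ?L"
    unfolding radial_Blaschke_sum_def power_body_def[symmetric] card diff_Suc_1
    by (rule power_body_cong) (simp only: K L)
  then have "\<Psi> (power_body (Suc k) (\<lambda>u. f u + g u)) = radial_Minkowski_sum (\<Psi> ?K) (\<Psi> ?L)"
    using hom K L by (simp add: radial_Blaschke_Minkowski_hom_def)
  also have "\<dots> = power_body 1 (\<lambda>u. radial (\<Psi> ?K) u + radial (\<Psi> ?L) u)"
    by (simp add: radial_Minkowski_sum_def power_body_def)
  finally have "T (\<lambda>u. f u + g u) = radial (power_body 1 (\<lambda>u. T f u + T g u))"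
    by (simp add: T_def)
  then show ?thesis
    using radial_power_body[OF nonneg_cont_add[OF T_nonneg_cont[OF f] T_nonneg_cont[OF g]], of 1 u] u
    by simp
qed

text \<open>Additivity applied to \<open>g = f + (g - f)\<close>, where \<open>T\<close> of the
  second summand is nonnegative.\<close>

lemma T_mono:
  assumes f: "f \<in> nonneg_cont" and g: "g \<in> nonneg_cont"
    and le: "\<And>u. norm u = 1 \<Longrightarrow> f u \<le> g u" and u: "norm u = 1"
  shows "T f u \<le> T g u"
proof -
  have d: "(\<lambda>u. g u - f u) \<in> nonneg_cont"
    using f g le by (rule nonneg_cont_diff)
  have "T g u = T f u + T (\<lambda>u. g u - f u) u"
    using T_add[OF f d u] by simp
  then show ?thesis using T_nonneg[OF d u] by simp
qed

text \<open>At a fixed \<open>u\<close>, the value is an additive nonnegative function of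
  \<open>c\<close> on the half-line, hence linear in \<open>c\<close>.\<close>

lemma T_cmult:
  assumes f: "f \<in> nonneg_cont" and c: "0 \<le> c" and u: "norm u = 1"
  shows "T (\<lambda>u. c * f u) u = c * T f u"
proof -
  have "T (\<lambda>v. c * f v) u = c * T (\<lambda>v. 1 * f v) u"
  proof (rule additive_nonneg_linear[where \<phi> = "\<lambda>c. T (\<lambda>v. c * f v) u"])
    show "T (\<lambda>v. (a + b) * f v) u = T (\<lambda>v. a * f v) u + T (\<lambda>v. b * f v) u"
      if "0 \<le> a" "0 \<le> b" for a b
      using T_add[OF nonneg_cont_cmult[OF that(1) f] nonneg_cont_cmult[OF that(2) f] u]
      by (simp add: distrib_right)
    show "0 \<le> T (\<lambda>v. a * f v) u" if "0 \<le> a" for a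
      using f that u by (intro T_nonneg nonneg_cont_cmult)
  qed fact
  then show ?thesis by simp
qed

lemma T_zero: "norm u = 1 \<Longrightarrow> T (\<lambda>u. 0) u = 0"
  using T_cmult[OF nonneg_cont_const[of 0], of 0 u] by simp

lemma T_sum:
  assumes "finite A" "\<And>a. a \<in> A \<Longrightarrow> f a \<in> nonneg_cont" and u: "norm u = 1"
  shows "T (\<lambda>u. \<Sum>a\<in>A. f a u) u = (\<Sum>a\<in>A. T (f a) u)"
  using assms(1,2)
proof (induction A rule: finite_induct)
  case empty
  then show ?case by (simp add: T_zero[OF u])
next
  case (insert a A)
  then have "T (\<lambda>u. f a u + (\<Sum>a\<in>A. f a u)) u = T (f a) u + T (\<lambda>u. \<Sum>a\<in>A. f a u) u"
    by (intro T_add nonneg_cont_sum u) auto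
  with insert show ?case by simp
qed

text \<open>Rotating a body by \<open>Q\<close> composes its radial function with the inverse
  rotation \<open>transpose Q\<close>, so that intertwining rotations carries over to
  \<open>T\<close>.\<close>

lemma T_rotate:
  assumes f: "f \<in> nonneg_cont" and Q: "rotation_matrix Q" and u: "norm u = 1"
  shows "T (\<lambda>u. f (transpose Q *v u)) u = T f (transpose Q *v u)"
    and rotate_nonneg_cont: "(\<lambda>u. f (transpose Q *v u)) \<in> nonneg_cont"
proof -
  let ?K = "power_body (Suc k) f" and ?Q = "\<lambda>x. Q *v x" and ?R = "\<lambda>x. transpose Q *v x"
  have orth: "orthogonal_matrix Q" using Q by (simp add: rotation_matrix_def)
  then have orthQ: "orthogonal_transformation ?Q"
    by (simp add: orthogonal_transformation_matrix matrix_of_matrix_vector_mul matrix_vector_mul_linear)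
  have R: "?Q (?R x) = x" for x
    using orth by (simp add: orthogonal_matrix_def matrix_vector_mul_assoc del: transpose_matrix_vector)
  have nR: "norm (?R x) = norm x" for x
    using orthogonal_transformation_norm[OF orthQ, of "?R x"] R by simp
  have cont: "continuous_on (sphere 0 1) ?R"
    by (rule matrix_vector_mult_linear_continuous_on)
  have "continuous_on (sphere 0 1) (\<lambda>u. f (?R u))"
    using nonneg_contD(1)[OF f] cont by (rule continuous_on_compose2)
      (auto simp: nR simp del: transpose_matrix_vector)
  then show "(\<lambda>u. f (?R u)) \<in> nonneg_cont"
    using nonneg_contD(2)[OF f] nR by (intro nonneg_contI) auto
  note image = star_body_image[OF _ orthQ R, of _ 1, simplified]
  have K: "?K \<in> star_bodies" "\<And>u. norm u = 1 \<Longrightarrow> radial ?K u ^ (Suc k) = f u"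
    using power_body[OF f zero_less_Suc] by auto
  have "power_body (Suc k) (\<lambda>u. f (?R u)) = ?Q ` ?K"
    using image[OF K(1)] K(2) nR by (intro power_body_eqI zero_less_Suc) auto
  then have "\<Psi> (power_body (Suc k) (\<lambda>u. f (?R u))) = ?Q ` \<Psi> ?K"
    using hom Q K(1) by (simp add: radial_Blaschke_Minkowski_hom_def)
  then show "T (\<lambda>u. f (?R u)) u = T f (?R u)"
    using image(2)[OF hom_star[OF K(1)] u] by (simp add: T_def)
qed

section \<open>Transitivity of rotations and the kernel of \<open>T\<close>\<close>

lemma rotation_matrix_exists:
  fixes a b :: "real ^ 'n"
  assumes "norm a = norm b"
  obtains Q where "rotation_matrix Q" "Q *v a = b"
proof -
  \<comment> \<open>Determinant \<open>1\<close> can be arranged because the dimension is at least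
    two.\<close>
  obtain f where f: "orthogonal_transformation f" "det (matrix f) = 1" "f a = b"
    using rotation_exists[OF _ assms] card by auto
  have "rotation_matrix (matrix f)" "matrix f *v a = b"
    using f by (auto simp: rotation_matrix_def orthogonal_transformation_matrix matrix_works)
  then show ?thesis by (rule that)
qed

text \<open>A continuous function on the sphere lies below a constant, so by monotonicity
  \<open>T\<close> would vanish on every power of a radial function and every
  \<open>\<Psi> L\<close> would be \<open>{0}\<close>.\<close>

lemma T_one_eq_zero_contradiction:
  assumes one: "\<And>u. norm u = 1 \<Longrightarrow> T (\<lambda>u. 1) u = 0"
  shows False
proof -
  have "\<Psi> L = {0}" if L: "L \<in> star_bodies" for L
  proof -
    let ?f = "\<lambda>u. radial L u ^ Suc k"
    have f: "?f \<in> nonneg_cont"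
      by (intro nonneg_cont_power radial_nonneg_cont L)
    have "bounded (?f ` sphere 0 1)"
      using nonneg_contD(1)[OF f] by (intro compact_imp_bounded compact_continuous_image) auto
    then obtain B where "\<forall>y\<in>?f ` sphere 0 1. norm y \<le> B"
      unfolding bounded_iff by blast
    then have B: "\<bar>?f u\<bar> \<le> B" if "norm u = 1" for u
      using that by auto
    have B': "?f u \<le> \<bar>B\<bar> * 1" if "norm u = 1" for u
      using B[OF that] by linarith
    have "T ?f u = 0" if u: "norm u = 1" for u
    proof -
      have "T ?f u \<le> T (\<lambda>u. \<bar>B\<bar> * 1) u"
        by (rule T_mono[OF f _ B' u]) (simp_all add: nonneg_cont_const)
      also have "\<dots> = 0"
        using T_cmult[OF nonneg_cont_const[of 1], of "\<bar>B\<bar>" u] one u by simp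
      finally show ?thesis using T_nonneg[OF f u] by simp
    qed
    then show ?thesis
      by (simp add: star_body_eq_zero_iff[OF hom_star[OF L]] radial_hom[OF L])
  qed
  then show False using nontrivial by (simp add: trivial_hom_def)
qed

text \<open>If \<open>h\<close> is positive somewhere, then by compactness finitely many rotates of \<open>h\<close> have a sum
  that is bounded below by a positive constant on the whole sphere.\<close>

lemma T_eq_zero_imp:
  assumes h: "h \<in> nonneg_cont" and zero: "\<And>u. norm u = 1 \<Longrightarrow> T h u = 0" and x: "norm x = 1"
  shows "h x = 0"
proof (rule ccontr)
  assume "h x \<noteq> 0"
  then have pos: "0 < h x" using nonneg_contD(2)[OF h x] by simp
  have "openin (top_of_set (sphere 0 1)) (sphere 0 1 \<inter> h -` {0<..})"
    using nonneg_contD(1)[OF h] by (intro continuous_openin_preimage_gen) auto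
  \<comment> \<open>The relatively open set is extended to an open subset of the whole space, so
    that its preimages under rotations form an open cover.\<close>
  then obtain W where W: "open W" "sphere 0 1 \<inter> h -` {0<..} = sphere 0 1 \<inter> W"
    by (auto simp: openin_open)
  have Wpos: "0 < h u" if "norm u = 1" "u \<in> W" for u
    using W(2) that by (auto simp: set_eq_iff)
  have xW: "x \<in> W" using W(2) pos x by (auto simp: set_eq_iff)
  let ?S = "{Q. rotation_matrix Q} :: (real ^ 'n ^ 'n) set"
  have cont: "continuous_on UNIV (\<lambda>u. transpose Q *v u)" for Q :: "real ^ 'n ^ 'n"
    by (rule matrix_vector_mult_linear_continuous_on)
  have op: "open ((\<lambda>u. transpose Q *v u) -` W)" for Q :: "real ^ 'n ^ 'n"
    using W(1) cont by (rule open_vimage)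
  have inverse_rot: "transpose Q *v (Q *v v) = v" if "rotation_matrix Q" for Q v
    using that by (simp add: rotation_matrix_def orthogonal_matrix_def matrix_vector_mul_assoc
      del: transpose_matrix_vector)
  have cover: "sphere 0 1 \<subseteq> (\<Union>Q\<in>?S. (\<lambda>u. transpose Q *v u) -` W)"
  proof
    fix y :: "real ^ 'n" assume "y \<in> sphere 0 1"
    then obtain Q where Q: "rotation_matrix Q" "Q *v x = y"
      using rotation_matrix_exists[of x y] x by auto
    have "transpose Q *v y \<in> W" using inverse_rot[OF Q(1), of x] Q(2) xW by simp
    with Q(1) show "y \<in> (\<Union>Q\<in>?S. (\<lambda>u. transpose Q *v u) -` W)" by auto
  qed
  obtain A where A: "A \<subseteq> ?S" "finite A" "sphere 0 1 \<subseteq> (\<Union>Q\<in>A. (\<lambda>u. transpose Q *v u) -` W)"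
    using compactE_image[OF compact_sphere op cover] by metis
  define s where "s u = (\<Sum>Q\<in>A. h (transpose Q *v u))" for u
  have rc: "(\<lambda>u. h (transpose Q *v u)) \<in> nonneg_cont" if "Q \<in> A" for Q
    using A(1) that x by (intro rotate_nonneg_cont[OF h _ x]) auto
  have norm_T: "norm (transpose Q *v u) = norm u" if "Q \<in> A" for Q u
  proof -
    have "orthogonal_matrix (transpose Q)"
      using A(1) that by (auto simp: rotation_matrix_def orthogonal_matrix_transpose)
    then have "orthogonal_transformation (\<lambda>x. transpose Q *v x)"
      by (simp add: orthogonal_transformation_matrix matrix_of_matrix_vector_mul matrix_vector_mul_linear
        del: transpose_matrix_vector)
    then show ?thesis by (rule orthogonal_transformation_norm)
  qed
  have s: "s \<in> nonneg_cont"
    unfolding s_def by (rule nonneg_cont_sum) (rule rc)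
  have s_pos: "0 < s u" if u: "norm u = 1" for u
  proof -
    obtain Q where Q: "Q \<in> A" "transpose Q *v u \<in> W"
      using A(3) u by auto
    have "0 < h (transpose Q *v u)"
      using Q u norm_T by (intro Wpos) auto
    then show ?thesis
      unfolding s_def using A(2) Q(1) nonneg_contD(2)[OF rc u]
      by (intro sum_pos2[of A Q])
  qed
  obtain v where v: "norm v = 1" "\<And>u. norm u = 1 \<Longrightarrow> s v \<le> s u"
    using continuous_attains_inf[OF compact_sphere _ nonneg_contD(1)[OF s]] x by auto
  have "T (\<lambda>u. 1) u = 0" if u: "norm u = 1" for u
  proof -
    \<comment> \<open>\<open>T s\<close> is a sum of rotates of \<open>T h\<close>, hence zero,
      while the constant \<open>s v\<close> is a positive lower bound of \<open>s\<close>.\<close>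
    have "s v * T (\<lambda>u. 1) u = T (\<lambda>u. s v * 1) u"
      using s_pos[OF v(1)] u by (intro T_cmult[symmetric] nonneg_cont_const) auto
    also have "\<dots> \<le> T s u"
      using s_pos[OF v(1)] v(2) by (intro T_mono[OF _ s _ u] nonneg_cont_cmult nonneg_cont_const) auto
    also have "T s u = (\<Sum>Q\<in>A. T (\<lambda>u. h (transpose Q *v u)) u)"
      unfolding s_def[abs_def] using A(2) rc u by (rule T_sum)
    also have "\<dots> = (\<Sum>Q\<in>A. T h (transpose Q *v u))"
      using A(1) by (intro sum.cong refl T_rotate[OF h _ u]) auto
    also have "\<dots> = 0"
      using norm_T u by (intro sum.neutral ballI zero) auto
    finally have "T (\<lambda>u. 1) u \<le> 0"
      using s_pos[OF v(1)] by (simp add: mult_le_0_iff)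
    then show ?thesis using T_nonneg[OF nonneg_cont_const[of 1] u] by simp
  qed
  then show False by (rule T_one_eq_zero_contradiction)
qed

end

subsection \<open>The inequality\<close>

lemma volume_eq_zero_iff:
  fixes M :: "(real ^ 'n::finite) set"
  assumes M: "M \<in> star_bodies"
  shows "volume M = 0 \<longleftrightarrow> M = {0}"
proof
  assume "volume M = 0"
  moreover have "sphere_integral (\<lambda>u::real ^ 'n. 0) = 0"
    by (simp add: sphere_integral_def)
  ultimately have eq: "sphere_integral (\<lambda>u::real ^ 'n. 0) = sphere_integral (\<lambda>u. radial M u ^ CARD('n))"
    by (simp add: volume_star_body[OF M])
  have "radial M u = 0" if u: "norm u = 1" for u
  proof -
    have f: "(\<lambda>u. radial M u ^ CARD('n)) \<in> nonneg_cont"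
      by (intro nonneg_cont_power radial_nonneg_cont M)
    have "0 = radial M u ^ CARD('n)"
      by (rule sphere_integral_eq_imp_eq[OF _ nonneg_contD(1)[OF f] nonneg_contD(2)[OF f] eq u]) auto
    then show ?thesis by simp
  qed
  then show "M = {0}" by (simp add: star_body_eq_zero_iff[OF M])
qed simp

lemma volume_radial_scale:
  fixes A B :: "(real ^ 'n::finite) set"
  assumes A: "A \<in> star_bodies" and B: "B \<in> star_bodies"
    and eq: "\<And>u. norm u = 1 \<Longrightarrow> radial A u = c * radial B u"
  shows "volume A = c ^ CARD('n) * volume B"
proof -
  have f: "continuous_on (sphere 0 1) (\<lambda>u. radial B u ^ CARD('n))"
    by (intro nonneg_contD(1)[OF nonneg_cont_power] radial_nonneg_cont B)
  have "volume A = sphere_integral (\<lambda>u. c ^ CARD('n) * radial B u ^ CARD('n) + 0 * radial B u ^ CARD('n))"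
    unfolding volume_star_body[OF A] sphere_integral_def
    by (intro set_lebesgue_integral_cong) (auto simp: eq norm_sgn_shell power_mult_distrib
        intro: borel_compact compact_shell)
  also have "\<dots> = c ^ CARD('n) * volume B"
    by (subst sphere_integral_lincomb[OF f f]) (simp add: volume_star_body[OF B])
  finally show ?thesis .
qed

text \<open>The parameters \<open>a\<close> and \<open>b\<close> will be chosen such that \<open>a A\<close> and \<open>b B\<close> have equal volume.\<close>

lemma volume_le_mean:
  fixes A B C :: "(real ^ 'n::finite) set"
  assumes A: "A \<in> star_bodies" and B: "B \<in> star_bodies" and C: "C \<in> star_bodies"
    and ab: "0 \<le> a" "0 \<le> b"
    and le: "\<And>u. norm u = 1 \<Longrightarrow>
      radial C u \<le> (real k * (a * radial A u) + b * radial B u) / real (Suc k)"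
    and v: "a ^ CARD('n) * volume A = v" "b ^ CARD('n) * volume B = v"
  shows "volume C \<le> v"
    and "volume C = v \<Longrightarrow> norm u = 1 \<Longrightarrow>
      radial C u = (real k * (a * radial A u) + b * radial B u) / real (Suc k)"
proof -
  let ?n = "CARD('n)"
  let ?D = "\<lambda>u. (real k * (a * radial A u) + b * radial B u) / real (Suc k)"
  \<comment> \<open>The \<open>n\<close>-th power of \<open>radial C\<close> is at most that of
    \<open>?D\<close>, which convexity bounds by \<open>?E\<close>, and \<open>?E\<close> integrates
    to \<open>v\<close>. If \<open>volume C = v\<close>, the outer terms agree pointwise and squeeze
    the middle one.\<close>
  let ?E = "\<lambda>u. (real k * a ^ ?n / real (Suc k)) * radial A u ^ ?n + (b ^ ?n / real (Suc k)) * radial B u ^ ?n"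
  have cont: "continuous_on (sphere 0 1) (radial A)" "continuous_on (sphere 0 1) (radial B)"
    "continuous_on (sphere 0 1) (radial C)"
    using A B C by (simp_all add: star_bodies_def)
  have contE: "continuous_on (sphere 0 1) ?E"
    by (intro continuous_intros cont)
  have le1: "radial C u ^ ?n \<le> ?D u ^ ?n" if "norm u = 1" for u
    by (intro power_mono le radial_nonneg C that)
  have le2: "?D u ^ ?n \<le> ?E u" if "norm u = 1" for u
  proof -
    have "?D u ^ ?n \<le> (real k * (a * radial A u) ^ ?n + (b * radial B u) ^ ?n) / real (Suc k)"
      by (intro mean_power_convex mult_nonneg_nonneg ab radial_nonneg A B that)
    also have "\<dots> = ?E u"
      by (simp add: power_mult_distrib add_divide_distrib)
    finally show ?thesis .
  qed
  have "sphere_integral ?E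
      = (real k * a ^ ?n / real (Suc k)) * volume A + (b ^ ?n / real (Suc k)) * volume B"
    unfolding volume_star_body[OF A] volume_star_body[OF B]
    by (rule sphere_integral_lincomb) (intro continuous_intros cont)+
  also have "\<dots> = (real k * (a ^ ?n * volume A) + b ^ ?n * volume B) / real (Suc k)"
    by (simp add: add_divide_distrib)
  also have "\<dots> = v"
    unfolding v by (simp add: field_simps)
  finally have E: "sphere_integral ?E = v" .
  have contC: "continuous_on (sphere 0 1) (\<lambda>u. radial C u ^ ?n)"
    by (intro continuous_intros cont)
  have le12: "radial C u ^ ?n \<le> ?E u" if "norm u = 1" for u
    using le1[OF that] le2[OF that] by (rule order_trans)
  show "volume C \<le> v"
    unfolding volume_star_body[OF C] E[symmetric] using contC contE le12
    by (rule sphere_integral_mono)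
  show "radial C u = ?D u" if "volume C = v" "norm u = 1"
  proof -
    have eq: "sphere_integral (\<lambda>u. radial C u ^ ?n) = sphere_integral ?E"
      using that(1) by (simp only: E volume_star_body[OF C])
    have "radial C u ^ ?n = ?E u"
      using contC contE le12 eq that(2) by (rule sphere_integral_eq_imp_eq)
    then have "radial C u ^ ?n = ?D u ^ ?n"
      using le1[OF that(2)] le2[OF that(2)] by linarith
    then show ?thesis
      by (rule power_eq_imp_eq_base)
        (use ab in \<open>auto intro!: divide_nonneg_pos add_nonneg_nonneg mult_nonneg_nonneg
          radial_nonneg A B C that(2)\<close>)
  qed
qed

context nontrivial_hom
begin

text \<open>The body \<open>{0}\<close> appears separately among the equality cases: both sides
  vanish for it, but with a positive factor it is a dilate only of itself.\<close>

lemma mixed_volume_inequality: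
  assumes K: "K \<in> star_bodies" and L: "L \<in> star_bodies"
  defines "V \<equiv> volume (mixed \<Psi> (replicate k K @ [L]))"
  shows "V ^ Suc k \<le> volume (\<Psi> K) ^ k * volume (\<Psi> L)" (is ?le)
    and "V ^ Suc k = volume (\<Psi> K) ^ k * volume (\<Psi> L)
      \<longleftrightarrow> dilates K L \<or> K = {0} \<or> L = {0}" (is "?eq \<longleftrightarrow> ?R")
proof -
  let ?n = "CARD('n)"
  let ?p = "radial K" and ?q = "radial L"
  let ?F = "\<lambda>u. ?p u ^ Suc k" and ?G = "\<lambda>u. ?q u ^ Suc k" and ?H = "\<lambda>u. ?p u ^ k * ?q u"
  note p = radial_nonneg_cont[OF K] and q = radial_nonneg_cont[OF L]
  note p0 = radial_nonneg[OF K] and q0 = radial_nonneg[OF L]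
  have F: "?F \<in> nonneg_cont" and G: "?G \<in> nonneg_cont" and H: "?H \<in> nonneg_cont"
    by (intro nonneg_cont_mult nonneg_cont_power p q)+
  define A where "A = \<Psi> K"
  define B where "B = \<Psi> L"
  define C where "C = mixed \<Psi> (replicate k K @ [L])"
  have C_eq: "C = \<Psi> (power_body (Suc k) ?H)"
    by (simp add: C_def mixed_def power_body_def card map_replicate prod_list_replicate)
  have A: "A \<in> star_bodies" and B: "B \<in> star_bodies" and C: "C \<in> star_bodies"
    using hom_star[OF K] hom_star[OF L] hom_star[OF power_body_star[OF H]]
    by (simp_all add: A_def B_def C_eq)
  have rA: "radial A = T ?F" and rB: "radial B = T ?G" and rC: "radial C = T ?H"
    using radial_hom[OF K] radial_hom[OF L] by (simp_all add: A_def B_def C_eq T_def)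
  \<comment> \<open>Since \<open>T\<close> annihilates only \<open>0\<close>, the volumes of
    \<open>A\<close> and \<open>B\<close> are positive for nonzero \<open>K\<close> and
    \<open>L\<close>, which permits the division defining \<open>r\<close>.\<close>
  have zero: "M = {0}" if M: "M \<in> star_bodies" and "\<Psi> M = {0}" for M
  proof -
    have "T (\<lambda>u. radial M u ^ Suc k) u = 0" if "norm u = 1" for u
      unfolding radial_hom[OF M, symmetric] \<open>\<Psi> M = {0}\<close> using that by (rule radial_zero)
    then have "radial M u ^ Suc k = 0" if "norm u = 1" for u
      using that
      by (rule T_eq_zero_imp[OF nonneg_cont_power[OF radial_nonneg_cont[OF M]]])
    then have "radial M u = 0" if "norm u = 1" for u
      using that power_not_zero by blast
    then show ?thesis by (simp add: star_body_eq_zero_iff[OF M])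
  qed
  have hom_zero: "\<Psi> {0} = {0}"
    using T_zero T_cong[of "\<lambda>u. radial {0} u ^ Suc k" "\<lambda>u. 0"]
    by (simp add: star_body_eq_zero_iff[OF hom_star[OF star_body_zero]] radial_hom[OF star_body_zero]
        radial_zero)
  have V: "V = volume C" by (simp add: V_def C_def)
  have "?le \<and> (?eq \<longleftrightarrow> ?R)"
  proof (cases "K = {0} \<or> L = {0}")
    case True
    then have "T ?H = T (\<lambda>u. 0)"
      using k_pos by (intro T_cong) (auto simp: radial_zero)
    then have "C = {0}"
      by (simp add: star_body_eq_zero_iff[OF C] rC T_zero)
    then have "V = 0"
      by (simp add: V)
    have "A = {0} \<or> B = {0}"
      using True hom_zero unfolding A_def B_def by blast
    then have "volume A = 0 \<or> volume B = 0"
      unfolding volume_eq_zero_iff[OF A] volume_eq_zero_iff[OF B] .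
    then have "volume A ^ k * volume B = 0"
      using k_pos by simp
    with True \<open>V = 0\<close> show ?thesis
      unfolding A_def B_def by simp
  next
    case False
    then have pos: "0 < volume A" "0 < volume B"
      using zero[OF K] zero[OF L] volume_eq_zero_iff[OF A] volume_eq_zero_iff[OF B]
      by (auto simp: A_def B_def zero_less_measure_iff)
    \<comment> \<open>Scaling \<open>p\<close> by \<open>r\<close> and \<open>q\<close> by
      \<open>1 / r ^ k\<close> preserves \<open>p ^ k * q\<close> and multiplies their
      \<open>Suc k\<close>-th powers by \<open>a\<close> and \<open>b\<close>. As
      \<open>a / b\<close> is \<open>r\<close> to the power \<open>Suc k * Suc k\<close>, this
      \<open>r\<close> makes \<open>a ^ n * volume A\<close> equal to
      \<open>b ^ n * volume B\<close>.\<close>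
    define r where "r = root (Suc k * Suc k * ?n) (volume B / volume A)"
    have r: "0 < r" using pos by (simp add: r_def del: mult_Suc)
    define a where "a = r ^ Suc k"
    define b where "b = 1 / (r ^ k) ^ Suc k"
    have ab: "0 < a" "0 < b" using r by (simp_all add: a_def b_def)
    have "(a ^ ?n) ^ Suc k = r ^ (Suc k * Suc k * ?n)"
      by (simp only: a_def power_mult[symmetric] ac_simps)
    also have "\<dots> = volume B / volume A"
      unfolding r_def using pos by (intro real_root_pow_pos2) auto
    finally have a_pow: "(a ^ ?n) ^ Suc k = volume B / volume A" .
    have "(r ^ k) ^ Suc k = a ^ k"
      by (simp only: a_def power_mult[symmetric] mult.commute)
    then have ba: "b * a ^ k = 1"
      using ab by (simp add: b_def del: power_Suc)
    \<comment> \<open>The common volume \<open>v\<close> is the weighted geometric mean of the two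
      volumes, so the claim becomes \<open>volume C \<le> v\<close>.\<close>
    define v where "v = a ^ ?n * volume A"
    have v0: "0 \<le> v"
      using ab by (simp add: v_def)
    have v_pow: "v ^ Suc k = volume A ^ k * volume B"
      unfolding v_def power_mult_distrib a_pow using pos by simp
    have "b ^ ?n * volume B = b ^ ?n * (a ^ ?n) ^ Suc k * volume A"
      unfolding a_pow using pos by simp
    also have "\<dots> = (b * a ^ k) ^ ?n * (a ^ ?n * volume A)"
      by (simp add: power_mult_distrib power_mult[symmetric] ac_simps)
    finally have vB: "b ^ ?n * volume B = v"
      by (simp add: ba v_def)
    let ?x = "\<lambda>u. r * ?p u" and ?y = "\<lambda>u. ?q u / r ^ k"
    have xF: "?x u ^ Suc k = a * ?F u" and yG: "?y u ^ Suc k = b * ?G u"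
      and xyH: "?x u ^ k * ?y u = ?H u" for u
      using r by (simp_all only: a_def b_def power_mult_distrib power_divide) simp_all
    have amgm: "real (Suc k) * ?H u \<le> real k * (a * ?F u) + b * ?G u" if "norm u = 1" for u
      using mean_power_ge[of "?x u" "?y u" k] p0[OF that] q0[OF that] r
      unfolding xF yG xyH by simp
    let ?M = "\<lambda>u. real k * (a * ?F u) + b * ?G u" and ?H' = "\<lambda>u. real (Suc k) * ?H u"
    have M: "?M \<in> nonneg_cont"
      using ab by (intro nonneg_cont_add nonneg_cont_cmult F G) auto
    have H': "?H' \<in> nonneg_cont"
      by (intro nonneg_cont_cmult H) simp
    have TM: "T ?M u = real k * (a * radial A u) + b * radial B u" if u: "norm u = 1" for u
    proof -
      have "T ?M u = T (\<lambda>u. real k * (a * ?F u)) u + T (\<lambda>u. b * ?G u) u"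
        using ab by (intro T_add nonneg_cont_cmult F G u) auto
      also have "T (\<lambda>u. real k * (a * ?F u)) u = real k * T (\<lambda>u. a * ?F u) u"
        using ab by (intro T_cmult nonneg_cont_cmult F u) auto
      also have "T (\<lambda>u. a * ?F u) u = a * radial A u"
        unfolding rA using ab by (intro T_cmult F u) auto
      also have "T (\<lambda>u. b * ?G u) u = b * radial B u"
        unfolding rB using ab by (intro T_cmult G u) auto
      finally show ?thesis .
    qed
    have TH: "T ?H' u = real (Suc k) * radial C u" if u: "norm u = 1" for u
      unfolding rC by (intro T_cmult H u) simp
    have le: "radial C u \<le> (real k * (a * radial A u) + b * radial B u) / real (Suc k)"
      if u: "norm u = 1" for u
      using T_mono[OF H' M amgm u] TM[OF u] TH[OF u]
      by (simp add: pos_le_divide_eq mult.commute del: of_nat_Suc)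
    note mean = volume_le_mean[OF A B C less_imp_le[OF ab(1)] less_imp_le[OF ab(2)] _ v_def[symmetric] vB]
    have "volume C \<le> v"
      using le by (rule mean(1))
    then have ?le
      using power_mono[of "volume C" v "Suc k"] v_pow by (simp only: V A_def B_def measure_nonneg)
    moreover have "dilates K L" if ?eq
    proof -
      have "volume C ^ Suc k = v ^ Suc k"
        using that by (simp only: V v_pow A_def B_def)
      then have "volume C = v"
        using measure_nonneg v0 by (rule power_eq_imp_eq_base) simp
      have rad: "radial C u = (real k * (a * radial A u) + b * radial B u) / real (Suc k)"
        if "norm u = 1" for u
        using le \<open>volume C = v\<close> that by (rule mean(2))
      \<comment> \<open>This is the defect of the mean inequality. By \<open>rad\<close>,
        \<open>T\<close> takes equal values on \<open>?M\<close> and \<open>?H'\<close>, so it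
        annihilates the defect.\<close>
      have D: "(\<lambda>u. ?M u - ?H' u) \<in> nonneg_cont"
        using H' M amgm by (rule nonneg_cont_diff)
      have TD: "T (\<lambda>u. ?M u - ?H' u) u = 0" if u: "norm u = 1" for u
      proof -
        have "T ?M u = T ?H' u + T (\<lambda>u. ?M u - ?H' u) u"
          using T_add[OF H' D u] by simp
        moreover have "T ?M u = T ?H' u"
          using TM[OF u] TH[OF u] rad[OF u] by (simp del: of_nat_Suc)
        ultimately show ?thesis by simp
      qed
      \<comment> \<open>Equality in the means gives \<open>r * p = q / r ^ k\<close>, and
        \<open>r ^ Suc k\<close> is \<open>a\<close>.\<close>
      have "?q u = a * ?p u" if u: "norm u = 1" for u
      proof -
        have "?M u = ?H' u"
          using T_eq_zero_imp[OF D TD u] by simp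
        then have eq: "real (Suc k) * (?x u ^ k * ?y u) = real k * ?x u ^ Suc k + ?y u ^ Suc k"
          unfolding xF yG xyH by (rule sym)
        have "?x u = ?y u"
          by (rule mean_power_eq[OF _ _ k_pos eq]) (use p0[OF u] q0[OF u] r in simp_all)
        then show ?thesis using r by (simp add: a_def field_simps)
      qed
      then have "\<forall>u\<in>sphere 0 1. radial K u = (1 / a) * radial L u"
        using ab by simp
      then show ?thesis
        unfolding dilates_iff_radial[OF K L] using ab by (intro exI[of _ "1 / a"]) simp
    qed
    \<comment> \<open>If \<open>p = c * q\<close>, then \<open>A\<close> and \<open>C\<close> are
      multiples of \<open>B\<close> by \<open>c ^ Suc k\<close> and \<open>c ^ k\<close>, and both
      sides carry the same power of \<open>c\<close>.\<close>
    moreover have ?eq if dil: "dilates K L"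
    proof -
      obtain c where c: "0 < c" "\<And>u. norm u = 1 \<Longrightarrow> ?p u = c * ?q u"
        using dil unfolding dilates_iff_radial[OF K L] by auto
      have "T ?F = T (\<lambda>u. c ^ Suc k * ?G u)"
        by (rule T_cong) (simp add: c power_mult_distrib)
      then have "radial A u = c ^ Suc k * radial B u" if "norm u = 1" for u
        unfolding rA rB using T_cmult[OF G _ that, of "c ^ Suc k"] c(1) by simp
      then have vA: "volume A = (c ^ Suc k) ^ ?n * volume B"
        by (rule volume_radial_scale[OF A B])
      have "T ?H = T (\<lambda>u. c ^ k * ?G u)"
        by (rule T_cong) (simp add: c power_mult_distrib)
      then have "radial C u = c ^ k * radial B u" if "norm u = 1" for u
        unfolding rC rB using T_cmult[OF G _ that, of "c ^ k"] c(1) by simp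
      then have vC: "volume C = (c ^ k) ^ ?n * volume B"
        by (rule volume_radial_scale[OF C B])
      show ?eq
        unfolding V A_def[symmetric] B_def[symmetric] vA vC
        by (simp only: power_mult_distrib power_mult[symmetric] power_Suc2[of "volume B"] ac_simps)
    qed
    ultimately show ?thesis using False by blast
  qed
  then show ?le and "?eq \<longleftrightarrow> ?R" by blast+
qed

end

theorem theorem1:
  fixes \<Psi> :: "(real ^ 'n::finite) set \<Rightarrow> (real ^ 'n) set"
    and K L :: "(real ^ 'n) set"
  assumes "CARD('n) \<ge> 3"
    and "radial_Blaschke_Minkowski_hom \<Psi>"
    and "\<not> trivial_hom \<Psi>"
    and "K \<in> star_bodies"
    and "L \<in> star_bodies"
  shows "volume (mixed \<Psi> (replicate (CARD('n) - 2) K @ [L])) ^ (CARD('n) - 1)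
           \<le> volume (\<Psi> K) ^ (CARD('n) - 2) * volume (\<Psi> L) \<and>
         (volume (mixed \<Psi> (replicate (CARD('n) - 2) K @ [L])) ^ (CARD('n) - 1)
           = volume (\<Psi> K) ^ (CARD('n) - 2) * volume (\<Psi> L)
           \<longleftrightarrow> dilates K L \<or> K = {0} \<or> L = {0})"
proof -
  have k: "CARD('n) - 1 = Suc (CARD('n) - 2)"
    using assms(1) by simp
  interpret nontrivial_hom \<Psi> "CARD('n) - 2"
    using assms by unfold_locales auto
  show ?thesis
    using mixed_volume_inequality[OF assms(4,5)] unfolding k by blast
qed

end
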